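(* Let $G$ and $H$ be finitely generated free groups with the rank of $H$ greater than $1$, let $n$ be the rank of $G$, and let $\psi:G\to H$ be any homomorphism. For a homomorphism $\phi:G\to H$ and $u,v\in H$, write $[u]=[v]$ if there is $z\in G$ with $u=\phi(z)v\psi(z)^{-1}$, and $[u]\ne[v]$ otherwise. Then the set \[ S=\{(\phi,u,v)\mid [u]\neq[v]\}, \] where $\phi$ ranges over homomorphisms $G\to H$ and $u,v$ range over $H$, viewed as a subset of $H^{n+2}$, is generic.
   Context: Fix free generators $a_1,\dots,a_n$ of $G$ and a free generating set of $H$. A homomorphism $\phi:G\to H$ is identified with the $n$-tuple $(\phi(a_1),\dots,\phi(a_n))\in H^n$, and a triple $(\phi,u,v)$ with the $(n+2)$-tuple $(\phi(a_1),\dots,\phi(a_n),u,v)\in H^{n+2}$. For a natural number $p$, $H_p$ is the set of elements of $H$ of reduced word length at most $p$. The asymptotic density of $S\subset H^l$ is \[ D(S)=\lim_{p\to\infty}\frac{|S\cap(H_p)^l|}{|(H_p)^l|}, \] with $|\cdot|$ cardinality, and $S$ is generic if $D(S)=1$. *)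

theory Defs
  imports Complex_Main "HOL-Algebra.Group"
begin

section \<open>Free generating sets and reduced word length\<close>

text \<open>A letter \<open>(x, True)\<close> stands for \<open>x\<close>, and \<open>(x, False)\<close> for the inverse of \<open>x\<close>.\<close>

type_synonym 'a letter = "'a \<times> bool"

definition letter_val :: "('a, 'm) monoid_scheme \<Rightarrow> 'a letter \<Rightarrow> 'a" where
  "letter_val G l = (if snd l then fst l else inv\<^bsub>G\<^esub> (fst l))"

definition word_val :: "('a, 'm) monoid_scheme \<Rightarrow> 'a letter list \<Rightarrow> 'a" where
  "word_val G w = foldr (\<lambda>l g. letter_val G l \<otimes>\<^bsub>G\<^esub> g) w \<one>\<^bsub>G\<^esub>"

definition reduced_words :: "'a set \<Rightarrow> 'a letter list set" where
  "reduced_words B = {w. set w \<subseteq> B \<times> UNIV \<and>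
     successively (\<lambda>l l'. \<not> (fst l = fst l' \<and> snd l \<noteq> snd l')) w}"

text \<open>The group \<open>G\<close> is free on \<open>B\<close>: every element is represented by exactly one
  reduced word in \<open>B\<close>.  The universal property is not used as the definition because
  it would have to quantify over groups on arbitrary types.\<close>

definition free_generating_set :: "('a, 'm) monoid_scheme \<Rightarrow> 'a set \<Rightarrow> bool" where
  "free_generating_set G B \<longleftrightarrow> group G \<and> B \<subseteq> carrier G \<and>
     (\<forall>g \<in> carrier G. \<exists>!w. w \<in> reduced_words B \<and> word_val G w = g)"

text \<open>Only meaningful when \<open>free_generating_set G B\<close> and \<open>g \<in> carrier G\<close>.\<close>

definition word_length :: "('a, 'm) monoid_scheme \<Rightarrow> 'a set \<Rightarrow> 'a \<Rightarrow> nat" where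
  "word_length G B g = length (THE w. w \<in> reduced_words B \<and> word_val G w = g)"

definition word_ball :: "('a, 'm) monoid_scheme \<Rightarrow> 'a set \<Rightarrow> nat \<Rightarrow> 'a set" where
  "word_ball G B p = {g \<in> carrier G. word_length G B g \<le> p}"


section \<open>Asymptotic density and genericity\<close>

text \<open>Cartesian powers are sets of lists of fixed length.\<close>

definition tuples :: "'a set \<Rightarrow> nat \<Rightarrow> 'a list set" where
  "tuples A l = {xs. length xs = l \<and> set xs \<subseteq> A}"

text \<open>\<open>S\<close> is meant to be a subset of \<open>tuples (carrier H) l\<close>; the limit is required to exist.\<close>

definition has_asymptotic_density ::
    "('a, 'm) monoid_scheme \<Rightarrow> 'a set \<Rightarrow> nat \<Rightarrow> 'a list set \<Rightarrow> real \<Rightarrow> bool" where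
  "has_asymptotic_density H B l S d \<longleftrightarrow>
     (\<lambda>p. real (card (S \<inter> tuples (word_ball H B p) l)) / real (card (tuples (word_ball H B p) l)))
       \<longlonglongrightarrow> d"

definition generic :: "('a, 'm) monoid_scheme \<Rightarrow> 'a set \<Rightarrow> nat \<Rightarrow> 'a list set \<Rightarrow> bool" where
  "generic H B l S \<longleftrightarrow> S \<subseteq> tuples (carrier H) l \<and> has_asymptotic_density H B l S 1"


section \<open>Doubly twisted conjugacy\<close>

definition doubly_twisted_conj ::
    "('a, 'm) monoid_scheme \<Rightarrow> ('b, 'k) monoid_scheme \<Rightarrow> ('a \<Rightarrow> 'b) \<Rightarrow> ('a \<Rightarrow> 'b) \<Rightarrow> 'b \<Rightarrow> 'b \<Rightarrow> bool"
  where
  "doubly_twisted_conj G H \<phi> \<psi> u v \<longleftrightarrow>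
     (\<exists>z \<in> carrier G. u = \<phi> z \<otimes>\<^bsub>H\<^esub> v \<otimes>\<^bsub>H\<^esub> inv\<^bsub>H\<^esub> (\<psi> z))"

end

theory Submission
  imports Defs
begin

text \<open>For fixed \<open>z\<close> the equation \<open>u = \<phi>(z) v \<psi>(z)\<inverse>\<close> determines \<open>u\<close> from \<open>\<phi>\<close> and \<open>v\<close>, so a
  tuple in the ball of radius \<open>p\<close> satisfies it with probability at most one over the size of the
  ball. Only finitely many \<open>z\<close> matter: outside a negligible set of tuples the words
  \<open>\<phi>(a\<^sub>i)\<close> are longer than \<open>7p/8\<close>, and fewer than \<open>p/8\<close> letters cancel between any two of them
  or their inverses. Then \<open>\<phi>(z)\<close> has length at least \<open>5p|z|/8\<close>, whereas
  \<open>u \<psi>(z) v\<inverse>\<close> has length at most \<open>2p + C|z|\<close>, a contradiction for \<open>|z| \<ge> 5\<close> and \<open>p > 5C\<close>.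
  All exceptional sets are compared with balls of radius \<open>p - p/8\<close>, whose relative size is at most
  \<open>2\<close> to the power \<open>-p/8\<close>.\<close>

section \<open>Words and normal forms\<close>

definition inv_letter :: "'a letter \<Rightarrow> 'a letter" where
  "inv_letter l = (fst l, \<not> snd l)"

definition inv_word :: "'a letter list \<Rightarrow> 'a letter list" where
  "inv_word w = rev (map inv_letter w)"

abbreviation map_word :: "('a \<Rightarrow> 'b) \<Rightarrow> 'a letter list \<Rightarrow> 'b letter list" where
  "map_word f \<equiv> map (apfst f)"

text \<open>Folded from the right, this always meets a tail that is already reduced, so comparing
  the new letter with the head is enough.\<close>

definition cancel_cons :: "'a letter \<Rightarrow> 'a letter list \<Rightarrow> 'a letter list" where
  "cancel_cons l w = (if w \<noteq> [] \<and> hd w = inv_letter l then tl w else l # w)"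

definition free_reduce :: "'a letter list \<Rightarrow> 'a letter list" where
  "free_reduce w = foldr cancel_cons w []"

lemma inv_letter_simps [simp]:
  "inv_letter (inv_letter l) = l" "fst (inv_letter l) = fst l" "snd (inv_letter l) \<longleftrightarrow> \<not> snd l"
  "inv_letter l \<noteq> l" "inv_letter l = inv_letter l' \<longleftrightarrow> l = l'"
  by (auto simp: inv_letter_def prod_eq_iff)

lemma inv_letter_swap: "inv_letter l = l' \<longleftrightarrow> l = inv_letter l'"
  by auto

lemma inv_word_simps [simp]:
  "inv_word [] = []" "inv_word (u @ w) = inv_word w @ inv_word u" "inv_word (inv_word w) = w"
  "length (inv_word w) = length w" "inv_word w = [] \<longleftrightarrow> w = []"
  by (simp_all add: inv_word_def rev_map comp_def)

lemma inv_word_inj [simp]: "inv_word u = inv_word w \<longleftrightarrow> u = w"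
  by (metis inv_word_simps(3))

lemma inv_word_Cons [simp]: "inv_word (l # w) = inv_word w @ [inv_letter l]"
  by (simp add: inv_word_def)

lemma last_inv_word: "w \<noteq> [] \<Longrightarrow> last (inv_word w) = inv_letter (hd w)"
  by (simp add: inv_word_def last_rev list.map_sel)

lemma take_inv_word: "k \<le> length w \<Longrightarrow> take k (inv_word w) = inv_word (drop (length w - k) w)"
  by (simp add: inv_word_def take_rev drop_map)

lemma reduced_words_iff:
  "w \<in> reduced_words B \<longleftrightarrow> fst ` set w \<subseteq> B \<and> successively (\<lambda>l l'. l' \<noteq> inv_letter l) w"
proof -
  have "(\<not> (fst l = fst l' \<and> snd l \<noteq> snd l')) = (l' \<noteq> inv_letter l)" for l l' :: "'a letter"
    by (auto simp: prod_eq_iff)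
  moreover have "set w \<subseteq> B \<times> UNIV \<longleftrightarrow> fst ` set w \<subseteq> B"
    by force
  ultimately show ?thesis
    by (simp add: reduced_words_def)
qed

lemma reduced_words_Nil [simp]: "[] \<in> reduced_words B"
  by (simp add: reduced_words_iff)

lemma reduced_words_singleton [simp]: "[l] \<in> reduced_words B \<longleftrightarrow> fst l \<in> B"
  by (simp add: reduced_words_iff)

lemma reduced_words_Cons:
  "l # w \<in> reduced_words B \<longleftrightarrow>
     fst l \<in> B \<and> w \<in> reduced_words B \<and> (w \<noteq> [] \<longrightarrow> hd w \<noteq> inv_letter l)"
  by (cases w) (auto simp: reduced_words_iff)

lemma reduced_words_append:
  "u @ w \<in> reduced_words B \<longleftrightarrow> u \<in> reduced_words B \<and> w \<in> reduced_words B \<and>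
     (u \<noteq> [] \<and> w \<noteq> [] \<longrightarrow> hd w \<noteq> inv_letter (last u))"
  by (auto simp: reduced_words_iff successively_append_iff)

lemma reduced_words_drop: "w \<in> reduced_words B \<Longrightarrow> drop k w \<in> reduced_words B"
  by (metis append_take_drop_id reduced_words_append)

lemma reduced_words_take: "w \<in> reduced_words B \<Longrightarrow> take k w \<in> reduced_words B"
  by (metis append_take_drop_id reduced_words_append)

lemma inv_word_reduced [simp]: "inv_word w \<in> reduced_words B \<longleftrightarrow> w \<in> reduced_words B"
proof -
  have "inv_word w \<in> reduced_words B" if "w \<in> reduced_words B" for w :: "'a letter list"
    using that
    by (induction w) (auto simp: reduced_words_append reduced_words_Cons last_inv_word inv_letter_swap)
  then show ?thesis
    by (metis inv_word_simps(3))
qed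

lemma reduced_words_fst: "w \<in> reduced_words B \<Longrightarrow> fst ` set w \<subseteq> B"
  by (simp add: reduced_words_iff)

lemma cancel_cons_reduced:
  "fst l \<in> B \<Longrightarrow> w \<in> reduced_words B \<Longrightarrow> cancel_cons l w \<in> reduced_words B"
  by (cases w) (auto simp: cancel_cons_def reduced_words_Cons)

lemma free_reduce_reduced: "fst ` set w \<subseteq> B \<Longrightarrow> free_reduce w \<in> reduced_words B"
  by (induction w) (auto simp: free_reduce_def cancel_cons_reduced)

lemma length_free_reduce_le: "length (free_reduce w) \<le> length w"
  by (induction w) (auto simp: free_reduce_def cancel_cons_def)

lemma (in group) word_val_simps [simp]:
  "word_val G [] = \<one>" "word_val G (l # w) = letter_val G l \<otimes> word_val G w"
  by (simp_all add: word_val_def)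

lemma (in group) letter_val_closed [simp]: "fst l \<in> carrier G \<Longrightarrow> letter_val G l \<in> carrier G"
  by (simp add: letter_val_def)

lemma (in group) word_val_closed [simp]: "fst ` set w \<subseteq> carrier G \<Longrightarrow> word_val G w \<in> carrier G"
  by (induction w) auto

lemma (in group) word_val_append:
  "fst ` set u \<subseteq> carrier G \<Longrightarrow> fst ` set w \<subseteq> carrier G \<Longrightarrow>
   word_val G (u @ w) = word_val G u \<otimes> word_val G w"
  by (induction u) (auto simp: m_assoc)

lemma (in group) letter_val_inv [simp]:
  "fst l \<in> carrier G \<Longrightarrow> letter_val G (inv_letter l) = inv letter_val G l"
  by (simp add: letter_val_def)

lemma fst_inv_word [simp]: "fst ` set (inv_word w) = fst ` set w"
  by (auto simp: inv_word_def image_image)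

lemma (in group) word_val_inv_word [simp]:
  "fst ` set w \<subseteq> carrier G \<Longrightarrow> word_val G (inv_word w) = inv word_val G w"
  by (induction w) (auto simp: word_val_append inv_mult_group)

lemma fst_map_word [simp]: "fst ` set (map_word f w) = f ` fst ` set w"
  by (auto simp: image_image)

text \<open>\<open>f\<close> need not be injective: only a letter next to its own inverse is
  removed, and the images of such a pair cancel in any group. Taking \<open>f\<close> to be the
  identity leads to invariance of values under reduction; a general \<open>f\<close> is needed to
  extend maps of generators to homomorphisms.\<close>

lemma (in group) word_val_map_cancel_cons:
  assumes "f (fst l) \<in> carrier G" and "f ` fst ` set w \<subseteq> carrier G"
  shows "word_val G (map_word f (cancel_cons l w)) = letter_val G (apfst f l) \<otimes> word_val G (map_word f w)"
proof (cases "w \<noteq> [] \<and> hd w = inv_letter l")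
  case True
  then obtain w' where w: "w = inv_letter l # w'"
    by (cases w) auto
  have "apfst f (inv_letter l) = inv_letter (apfst f l)"
    by (simp add: prod_eq_iff)
  moreover have "fst ` set (map_word f w') \<subseteq> carrier G"
    using assms(2) w by (simp only: fst_map_word) auto
  then have "word_val G (map_word f w') \<in> carrier G"
    by (rule word_val_closed)
  ultimately show ?thesis
    using assms(1) w by (simp add: cancel_cons_def m_assoc [symmetric])
qed (auto simp: cancel_cons_def)

lemma fst_free_reduce: "fst ` set (free_reduce w) \<subseteq> fst ` set w"
  using free_reduce_reduced[OF subset_refl] by (rule reduced_words_fst)

lemma (in group) word_val_map_free_reduce:
  "f ` fst ` set w \<subseteq> carrier G \<Longrightarrow> word_val G (map_word f (free_reduce w)) = word_val G (map_word f w)"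
proof (induction w)
  case (Cons l w)
  have "f ` fst ` set (free_reduce w) \<subseteq> carrier G"
    using Cons.prems fst_free_reduce[of w] by fastforce
  then show ?case
    using Cons by (simp add: free_reduce_def word_val_map_cancel_cons)
qed (simp add: free_reduce_def)

lemma (in group) word_val_free_reduce:
  "fst ` set w \<subseteq> carrier G \<Longrightarrow> word_val G (free_reduce w) = word_val G w"
  using word_val_map_free_reduce[of id w] by (simp add: apfst_id)

section \<open>Normal forms and cancellation in a free group\<close>

locale free_group = group G for G (structure) +
  fixes B
  assumes free: "free_generating_set G B"
begin

text \<open>Names the word measured by \<open>word_length\<close>, so that cancellation can be
  followed letter by letter.\<close>

definition nf :: "'a \<Rightarrow> 'a letter list" where
  "nf g = (THE w. w \<in> reduced_words B \<and> word_val G w = g)"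

lemma generators_closed: "B \<subseteq> carrier G"
  using free by (simp add: free_generating_set_def)

lemma word_length_eq: "word_length G B g = length (nf g)"
  by (simp add: word_length_def nf_def)

lemma
  assumes "g \<in> carrier G"
  shows nf_reduced: "nf g \<in> reduced_words B" and word_val_nf: "word_val G (nf g) = g"
proof -
  have "\<exists>!w. w \<in> reduced_words B \<and> word_val G w = g"
    using free assms by (simp add: free_generating_set_def)
  from theI'[OF this] show "nf g \<in> reduced_words B" "word_val G (nf g) = g"
    by (simp_all add: nf_def)
qed

lemma fst_reduced_closed: "w \<in> reduced_words B \<Longrightarrow> fst ` set w \<subseteq> carrier G"
  using reduced_words_fst generators_closed by blast

lemma nf_fst: "g \<in> carrier G \<Longrightarrow> fst ` set (nf g) \<subseteq> carrier G"
  by (simp add: fst_reduced_closed nf_reduced)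

lemma nf_word_val:
  assumes "w \<in> reduced_words B"
  shows "nf (word_val G w) = w"
proof -
  have g: "word_val G w \<in> carrier G"
    using assms by (intro word_val_closed fst_reduced_closed)
  have "\<exists>!w'. w' \<in> reduced_words B \<and> word_val G w' = word_val G w"
    using free g by (simp add: free_generating_set_def)
  then show ?thesis
    using assms nf_reduced[OF g] word_val_nf[OF g] by auto
qed

lemma nf_unique: "w \<in> reduced_words B \<Longrightarrow> word_val G w = g \<Longrightarrow> nf g = w"
  using nf_word_val by blast

lemma nf_one: "nf \<one> = []"
  by (rule nf_unique) simp_all

lemma nf_inv: "g \<in> carrier G \<Longrightarrow> nf (inv g) = inv_word (nf g)"
  by (rule nf_unique) (simp_all add: nf_reduced nf_fst word_val_nf)

lemma nf_word_val_free_reduce: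
  assumes "fst ` set w \<subseteq> B"
  shows "nf (word_val G w) = free_reduce w"
  by (rule nf_unique)
    (use assms generators_closed in \<open>auto intro!: free_reduce_reduced word_val_free_reduce\<close>)

lemma nf_mult:
  assumes "g \<in> carrier G" "h \<in> carrier G"
  shows "nf (g \<otimes> h) = free_reduce (nf g @ nf h)"
proof -
  have "g \<otimes> h = word_val G (nf g @ nf h)"
    using assms by (simp add: word_val_append nf_fst word_val_nf)
  moreover have "fst ` set (nf g @ nf h) \<subseteq> B"
    using reduced_words_fst[OF nf_reduced] assms by (simp add: image_Un)
  ultimately show ?thesis
    using nf_word_val_free_reduce by metis
qed

lemma length_nf_mult:
  assumes "g \<in> carrier G" "h \<in> carrier G"
  shows "length (nf (g \<otimes> h)) \<le> length (nf g) + length (nf h)"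
  using length_free_reduce_le[of "nf g @ nf h"] assms by (simp add: nf_mult)

text \<open>All cancellation happens at the junction. Once the longest matching piece is removed,
  the letters that meet are not inverse to each other, so the remaining word is reduced and
  uniqueness makes it the normal form.\<close>

lemma nf_cancel:
  assumes g: "g \<in> carrier G" and h: "h \<in> carrier G"
  obtains a b c where "nf g = a @ inv_word c" "nf h = c @ b" "nf (g \<otimes> h) = a @ b"
proof -
  \<comment> \<open>The prefix is sought in the inverse of \<open>nf g\<close>, so the local
    \<open>a\<close> is the inverse of the \<open>a\<close> in the conclusion.\<close>
  obtain c a b where a: "inv_word (nf g) = c @ a" and b: "nf h = c @ b"
    and ab: "a = [] \<or> b = [] \<or> hd a \<noteq> hd b"
    using longest_common_prefix by blast
  have g': "nf g = inv_word a @ inv_word c"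
    using a by (metis inv_word_simps(2,3))
  have red: "a \<in> reduced_words B" "b \<in> reduced_words B" "c \<in> reduced_words B"
    using nf_reduced[OF g] nf_reduced[OF h] by (auto simp: g' b reduced_words_append)
  have "nf (g \<otimes> h) = inv_word a @ b"
  proof (rule nf_unique)
    show "inv_word a @ b \<in> reduced_words B"
      using red ab by (auto simp: reduced_words_append last_inv_word)
    have cancel: "inv x \<otimes> (x \<otimes> y) = y" if "x \<in> carrier G" "y \<in> carrier G" for x y
      using that by (simp add: m_assoc [symmetric])
    note red[THEN fst_reduced_closed]
    then have "word_val G (inv_word a @ b) = word_val G (nf g) \<otimes> word_val G (nf h)"
      by (simp add: g' b word_val_append m_assoc cancel image_Un)
    then show "word_val G (inv_word a @ b) = g \<otimes> h"
      using g h by (simp add: word_val_nf)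
  qed
  with g' b that show ?thesis
    by blast
qed

end

section \<open>Homomorphisms out of a free group\<close>

lemma free_group_iff: "free_group G B \<longleftrightarrow> free_generating_set G B"
  by (auto simp: free_group_def free_group_axioms_def free_generating_set_def)

lemma hom_word_val:
  assumes "group G" "group H" "\<phi> \<in> hom G H" "fst ` set w \<subseteq> carrier G"
  shows "\<phi> (word_val G w) = word_val H (map_word \<phi> w)"
proof -
  interpret group_hom G H \<phi>
    using assms by (simp add: group_hom_def group_hom_axioms_def)
  show ?thesis
    using assms(4) by (induction w) (auto simp: letter_val_def)
qed

text \<open>The existence half of the universal property. Evaluating \<open>f\<close> along normal
  forms is multiplicative because reducing a word does not change the value of its image.\<close>

lemma (in free_group) hom_exists:
  assumes "group H" and f: "f ` B \<subseteq> carrier H"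
  obtains \<phi> where "\<phi> \<in> hom G H" "\<And>x. x \<in> B \<Longrightarrow> \<phi> x = f x"
proof -
  interpret H: group H by fact
  define \<phi> where "\<phi> g = word_val H (map_word f (nf g))" for g
  have nf_B: "fst ` set (nf g) \<subseteq> B" if "g \<in> carrier G" for g
    using that by (simp add: nf_reduced reduced_words_fst)
  have closed: "f ` fst ` set (nf g) \<subseteq> carrier H" if "g \<in> carrier G" for g
    using nf_B[OF that] f by blast
  have "\<phi> \<in> hom G H"
  proof (rule homI)
    fix g h assume gh: "g \<in> carrier G" "h \<in> carrier G"
    have "f ` fst ` set (nf g @ nf h) \<subseteq> carrier H"
      using closed gh by (simp only: set_append image_Un) auto
    then show "\<phi> (g \<otimes> h) = \<phi> g \<otimes>\<^bsub>H\<^esub> \<phi> h"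
      using gh closed
      by (simp add: \<phi>_def nf_mult H.word_val_map_free_reduce H.word_val_append
          del: set_map list.set_map)
  qed (use closed in \<open>simp add: \<phi>_def del: set_map list.set_map\<close>)
  moreover have "\<phi> x = f x" if x: "x \<in> B" for x
  proof -
    have "nf x = [(x, True)]"
      using x generators_closed by (intro nf_unique) (auto simp: letter_val_def)
    moreover have "f x \<in> carrier H"
      using x f by blast
    ultimately show ?thesis
      by (simp add: \<phi>_def letter_val_def)
  qed
  ultimately show ?thesis
    using that by blast
qed

section \<open>Counting in balls\<close>

abbreviation ball_words :: "'a set \<Rightarrow> nat \<Rightarrow> 'a letter list set" where
  "ball_words B p \<equiv> {w \<in> reduced_words B. length w \<le> p}"

lemma finite_ball_words:
  assumes "finite B"
  shows "finite (ball_words B p)"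
proof (rule finite_subset)
  show "ball_words B p \<subseteq> {w. set w \<subseteq> B \<times> UNIV \<and> length w \<le> p}"
    by (auto simp: reduced_words_def)
qed (use assms in \<open>simp add: finite_lists_length_le\<close>)

text \<open>Any reduced word can be extended by both letters of a generator different from its last one.\<close>

lemma card_ball_words_Suc:
  assumes "finite B" and "card B > 1"
  shows "2 * card (ball_words B p) \<le> card (ball_words B (Suc p))"
proof -
  have "\<exists>y. \<forall>s. w @ [(y, s)] \<in> reduced_words B" if w: "w \<in> reduced_words B" for w
  proof -
    obtain y where "y \<in> B" "w \<noteq> [] \<longrightarrow> y \<noteq> fst (last w)"
      using assms by (metis One_nat_def card_le_Suc0_iff_eq linorder_not_less)
    then show ?thesis
      using w by (intro exI[of _ y]) (auto simp: reduced_words_append inv_letter_def prod_eq_iff)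
  qed
  then obtain y where y: "\<And>w s. w \<in> reduced_words B \<Longrightarrow> w @ [(y w, s)] \<in> reduced_words B"
    by metis
  have "inj_on (\<lambda>(w, s). w @ [(y w, s)]) (ball_words B p \<times> (UNIV :: bool set))"
    by (auto simp: inj_on_def)
  then have "card (ball_words B p \<times> (UNIV :: bool set)) \<le> card (ball_words B (Suc p))"
    by (rule card_inj_on_le) (use y assms(1) in \<open>auto simp: finite_ball_words\<close>)
  then show ?thesis
    by (simp add: card_cartesian_product)
qed

text \<open>Iterated doubling; this is the source of the exponential decay of the exceptional
  proportion.\<close>

lemma card_ball_words_diff:
  assumes "finite B" and "card B > 1" and "t \<le> p"
  shows "2 ^ t * card (ball_words B (p - t)) \<le> card (ball_words B p)"
  using assms(3)
proof (induction t)
  case (Suc t)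
  have "2 * card (ball_words B (p - Suc t)) \<le> card (ball_words B (p - t))"
    using card_ball_words_Suc[OF assms(1,2), of "p - Suc t"] Suc.prems by (simp add: Suc_diff_Suc)
  then have "2 ^ Suc t * card (ball_words B (p - Suc t)) \<le> 2 ^ t * card (ball_words B (p - t))"
    by simp
  with Suc show ?case
    by linarith
qed simp

section \<open>Counting tuples along one coordinate\<close>

lemma card_tuples: "finite X \<Longrightarrow> card (tuples X m) = card X ^ m"
  using card_lists_length_eq[of X m] by (simp add: tuples_def conj_commute)

lemma finite_tuples: "finite X \<Longrightarrow> finite (tuples X m)"
  using finite_lists_length_eq[of X m] by (simp add: tuples_def conj_commute)

text \<open>Deleting entry \<open>i\<close> maps \<open>A\<close> into the \<open>m\<close>-tuples
  over \<open>X\<close>. Two elements of \<open>A\<close> with the same image differ at most in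
  entry \<open>i\<close>, so each nonempty fibre has at most \<open>c\<close> elements.\<close>

lemma card_tuples_fibre_le:
  assumes X: "finite X" and A: "A \<subseteq> tuples X (Suc m)" and i: "i \<le> m"
    and fibre: "\<And>xs. xs \<in> A \<Longrightarrow> card {x \<in> X. xs[i := x] \<in> A} \<le> c"
  shows "card A \<le> c * card X ^ m"
proof -
  define del where "del xs = take i xs @ drop (Suc i) xs" for xs :: "'a list"
  have finA: "finite A"
    using A X finite_tuples finite_subset by blast
  have upd: "xs = ys[i := xs ! i]"
    if "del xs = del ys" "length xs = Suc m" "length ys = Suc m" for xs ys
  proof -
    have "take i xs = take i ys" "drop (Suc i) xs = drop (Suc i) ys"
      using that i by (simp_all add: del_def)
    then show ?thesis
      using that i by (metis id_take_nth_drop le_imp_less_Suc upd_conv_take_nth_drop)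
  qed
  have del_A: "del ` A \<subseteq> tuples X m"
  proof
    fix ys assume "ys \<in> del ` A"
    then obtain xs where xs: "xs \<in> A" "ys = del xs"
      by blast
    have "set ys \<subseteq> set xs"
      using set_take_subset set_drop_subset xs(2) by (fastforce simp: del_def)
    then show "ys \<in> tuples X m"
      using xs A i by (auto simp: tuples_def del_def)
  qed
  have "card {xs \<in> A. del xs = y} \<le> c" if y: "y \<in> del ` A" for y
  proof -
    obtain ys where ys: "ys \<in> A" "y = del ys"
      using y by blast
    have "{xs \<in> A. del xs = y} \<subseteq> (\<lambda>x. ys[i := x]) ` {x \<in> X. ys[i := x] \<in> A}"
    proof
      fix xs assume "xs \<in> {xs \<in> A. del xs = y}"
      then have xs: "xs \<in> A" "del xs = del ys" "length xs = Suc m" "length ys = Suc m" "xs ! i \<in> X"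
        using ys A i by (auto simp: tuples_def subset_iff)
      then show "xs \<in> (\<lambda>x. ys[i := x]) ` {x \<in> X. ys[i := x] \<in> A}"
        using upd[of xs ys] by (intro image_eqI[of _ _ "xs ! i"]) auto
    qed
    then have "card {xs \<in> A. del xs = y} \<le> card {x \<in> X. ys[i := x] \<in> A}"
      by (rule surj_card_le[rotated]) (use X in simp)
    then show ?thesis
      using fibre[OF ys(1)] by (rule order_trans)
  qed
  then have "(\<Sum>y\<in>del ` A. card {xs \<in> A. del xs = y}) \<le> card (del ` A) * c"
    using sum_bounded_above[of "del ` A" "\<lambda>y. card {xs \<in> A. del xs = y}" c] by simp
  moreover have "A = (\<Union>y\<in>del ` A. {xs \<in> A. del xs = y})"
    by blast
  then have "card A \<le> (\<Sum>y\<in>del ` A. card {xs \<in> A. del xs = y})"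
    using card_UN_le[of "del ` A" "\<lambda>y. {xs \<in> A. del xs = y}"] finA by simp
  moreover have "card (del ` A) \<le> card X ^ m"
    using del_A X by (metis card_mono card_tuples finite_tuples)
  ultimately show ?thesis
    by (metis (no_types, lifting) dual_order.trans mult.commute mult_le_mono2)
qed

section \<open>Elements of a ball with constrained prefixes\<close>

context free_group
begin

lemma nf_inj: "g \<in> carrier G \<Longrightarrow> h \<in> carrier G \<Longrightarrow> nf g = nf h \<Longrightarrow> g = h"
  by (metis word_val_nf)

lemma nf_letter_val:
  "g \<in> carrier G \<Longrightarrow> nf (letter_val G (g, s)) = (if s then nf g else inv_word (nf g))"
  by (simp add: letter_val_def nf_inv)

lemma word_ball_iff: "g \<in> word_ball G B p \<longleftrightarrow> g \<in> carrier G \<and> length (nf g) \<le> p"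
  by (simp add: word_ball_def word_length_eq)

lemma nf_word_ball: "bij_betw nf (word_ball G B p) (ball_words B p)"
  by (rule bij_betw_byWitness[where f' = "word_val G"])
    (auto simp: word_ball_iff nf_word_val word_val_nf nf_reduced fst_reduced_closed
      simp del: set_map)

lemma card_word_ball: "card (word_ball G B p) = card (ball_words B p)"
  using nf_word_ball by (rule bij_betw_same_card)

lemma finite_word_ball: "finite B \<Longrightarrow> finite (word_ball G B p)"
  using nf_word_ball finite_ball_words bij_betw_finite by blast

text \<open>With the first \<open>t\<close> letters fixed, the element is determined by the rest of
  the word, which is reduced of length at most \<open>p - t\<close>. The sign \<open>s\<close>
  selects the element or its inverse.\<close>

lemma card_word_ball_prefix:
  assumes "finite B"
  shows "card {g \<in> word_ball G B p. t \<le> length (nf g) \<and> take t (nf (letter_val G (g, s))) = w}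
         \<le> card (word_ball G B (p - t))" (is "card ?A \<le> _")
proof -
  have "inj_on (\<lambda>g. drop t (nf (letter_val G (g, s)))) ?A"
  proof (rule inj_onI)
    fix g h
    assume g: "g \<in> ?A" and h: "h \<in> ?A"
      and eq: "drop t (nf (letter_val G (g, s))) = drop t (nf (letter_val G (h, s)))"
    have "take t (nf (letter_val G (g, s))) = take t (nf (letter_val G (h, s)))"
      using g h by simp
    with eq have "nf (letter_val G (g, s)) = nf (letter_val G (h, s))"
      by (metis append_take_drop_id)
    then show "g = h"
      using g h by (auto simp: word_ball_iff nf_letter_val nf_inj split: if_splits)
  qed
  then show ?thesis
    unfolding card_word_ball
    by (rule card_inj_on_le)
      (use assms in \<open>auto simp: word_ball_iff nf_letter_val reduced_words_drop nf_reduced finite_ball_words\<close>)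
qed

text \<open>A word that begins with \<open>x\<close> and ends with the inverse of \<open>x\<close> is determined by what precedes its end.\<close>

lemma card_word_ball_self_inverse_prefix:
  assumes "finite B"
  shows "card {g \<in> word_ball G B p. 2 * t \<le> length (nf g) \<and> take t (nf g) = take t (inv_word (nf g))}
         \<le> card (word_ball G B (p - t))" (is "card ?A \<le> _")
proof -
  define init where "init g = take (length (nf g) - t) (nf g)" for g
  have recover: "nf g = init g @ inv_word (take t (init g))" if "g \<in> ?A" for g
  proof -
    \<comment> \<open>Since \<open>2 * t \<le> length (nf g)\<close>, the first \<open>t\<close>
      letters survive the removal of the last \<open>t\<close>.\<close>
    have "min t (length (nf g) - t) = t"
      using that by auto
    then have "take t (init g) = take t (nf g)"
      by (simp only: init_def take_take)
    also have "\<dots> = inv_word (drop (length (nf g) - t) (nf g))"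
      using that by (simp add: take_inv_word)
    finally show ?thesis
      by (simp add: init_def)
  qed
  have "inj_on init ?A"
  proof (rule inj_onI)
    fix g h assume g: "g \<in> ?A" and h: "h \<in> ?A" and eq: "init g = init h"
    have "nf g = nf h"
      using recover[OF g] recover[OF h] unfolding eq by (rule trans[OF _ sym])
    then show "g = h"
      using g h by (intro nf_inj) (simp_all add: word_ball_iff)
  qed
  then show ?thesis
    unfolding card_word_ball
    by (rule card_inj_on_le)
      (use assms in \<open>auto simp: init_def word_ball_iff reduced_words_take nf_reduced finite_ball_words\<close>)
qed

section \<open>Length of a word after substitution for its generators\<close>

lemma length_nf_map_word_le:
  assumes "f ` A \<subseteq> carrier G" and "\<And>x. x \<in> A \<Longrightarrow> length (nf (f x)) \<le> c" and "fst ` set w \<subseteq> A"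
  shows "length (nf (word_val G (map_word f w))) \<le> length w * c"
  using assms(3)
proof (induction w)
  case (Cons l w)
  have f: "f (fst l) \<in> carrier G" "f ` fst ` set w \<subseteq> carrier G"
    using Cons.prems assms(1) by auto
  have "apfst f l = (f (fst l), snd l)"
    by (simp add: prod_eq_iff)
  then have "length (nf (letter_val G (apfst f l))) \<le> c"
    using Cons.prems assms(2) f(1) by (simp add: nf_letter_val)
  moreover have "word_val G (map_word f w) \<in> carrier G"
    using f(2) by (intro word_val_closed) (simp only: fst_map_word)
  ultimately show ?case
    using length_nf_mult[of "letter_val G (apfst f l)" "word_val G (map_word f w)"] Cons f(1) by simp
qed (simp add: nf_one)

text \<open>If the images of distinct letters have distinct prefixes of length \<open>t\<close>, then
  fewer than \<open>t\<close> letters cancel on either side of each junction.\<close>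

lemma length_nf_map_word_ge:
  assumes f: "f ` A \<subseteq> carrier G"
    and long: "\<And>x. x \<in> A \<Longrightarrow> m \<le> length (nf (f x))" and t: "2 * t \<le> m"
    and prefix: "\<And>l l'. fst l \<in> A \<Longrightarrow> fst l' \<in> A \<Longrightarrow> l \<noteq> l' \<Longrightarrow>
      take t (nf (letter_val G (apfst f l))) \<noteq> take t (nf (letter_val G (apfst f l')))"
    and w: "w \<in> reduced_words A"
  shows "length w * (m - 2 * t) \<le> length (nf (word_val G (map_word f w)))"
proof -
  define r where "r l = nf (letter_val G (apfst f l))" for l
  have apfst_eq: "apfst f l = (f (fst l), snd l)" for l :: "'c letter"
    by (simp add: prod_eq_iff)
  have r_long: "m \<le> length (r l)" if "fst l \<in> A" for l
    using that long f by (auto simp: r_def apfst_eq nf_letter_val)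
  have r_inv: "r (inv_letter l) = inv_word (r l)" if "fst l \<in> A" for l
    using that f by (auto simp: r_def apfst_eq nf_letter_val)
  \<comment> \<open>The induction also carries that all but the last \<open>t\<close> letters of the
    first image survive. This controls the cancellation when another letter is put in front.\<close>
  have "(w \<noteq> [] \<longrightarrow> take (length (r (hd w)) - t) (nf (word_val G (map_word f w)))
          = take (length (r (hd w)) - t) (r (hd w))) \<and>
        length w * (m - 2 * t) \<le> length (nf (word_val G (map_word f w)))"
    using w
  proof (induction w)
    case (Cons l w)
    have l: "fst l \<in> A" and w: "w \<in> reduced_words A"
      and junction: "w \<noteq> [] \<Longrightarrow> hd w \<noteq> inv_letter l"
      using Cons.prems by (auto simp: reduced_words_Cons)
    define g h where "g = letter_val G (apfst f l)" and "h = word_val G (map_word f w)"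
    have g: "g \<in> carrier G" and nf_g: "nf g = r l"
      using l f by (auto simp: g_def r_def)
    have "f ` fst ` set w \<subseteq> carrier G"
      using reduced_words_fst[OF w] f by blast
    then have h: "h \<in> carrier G"
      unfolding h_def by (intro word_val_closed) (simp only: fst_map_word)
    have IH: "length w * (m - 2 * t) \<le> length (nf h)"
      "w \<noteq> [] \<Longrightarrow> take (length (r (hd w)) - t) (nf h) = take (length (r (hd w)) - t) (r (hd w))"
      using Cons.IH w by (auto simp: h_def)
    have val: "word_val G (map_word f (l # w)) = g \<otimes> h"
      by (simp add: g_def h_def)
    show ?case
    proof (cases "w = []")
      case True
      then have "g \<otimes> h = g"
        using g by (simp add: h_def)
      then show ?thesis
        unfolding val \<open>g \<otimes> h = g\<close> nf_g using r_long[OF l] True by simp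
    next
      case False
      obtain a b c where a: "nf g = a @ inv_word c" and b: "nf h = c @ b" and ab: "nf (g \<otimes> h) = a @ b"
        using nf_cancel[OF g h] .
      have r_l: "r l = a @ inv_word c"
        using a nf_g by simp
      have hd_w: "fst (hd w) \<in> A"
        using reduced_words_fst[OF w] False by auto
      \<comment> \<open>If \<open>t\<close> or more letters cancelled, \<open>nf h\<close> would
        begin like the image of \<open>inv_letter l\<close> and, by induction, like that of
        \<open>hd w\<close>. These letters differ because the word is reduced, contrary to
        \<open>prefix\<close>.\<close>
      have "length c < t"
      proof (rule ccontr)
        assume "\<not> length c < t"
        then have "take t (nf h) = take t (r (inv_letter l))"
          using b r_inv[OF l] r_l by simp
        moreover have "take t (nf h) = take t (r (hd w))"
        proof -
          \<comment> \<open>The surviving part has at least \<open>t\<close> letters, as the image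
            has length at least \<open>m\<close> and \<open>2 * t \<le> m\<close>.\<close>
          have "min t (length (r (hd w)) - t) = t"
            using r_long[OF hd_w] t by linarith
          then show ?thesis
            using arg_cong[OF IH(2)[OF False], of "take t"] by (simp only: take_take)
        qed
        ultimately show False
          using prefix[of "inv_letter l" "hd w"] l hd_w junction[OF False] by (simp add: r_def)
      qed
      moreover have "length (r l) = length a + length c"
        by (simp add: r_l)
      \<comment> \<open>The product loses \<open>length c\<close> letters from each factor, hence
        fewer than \<open>2 * t\<close> in all when \<open>t > 0\<close> is forced by
        \<open>length c < t\<close>.\<close>
      ultimately have "length (r l) - t \<le> length a" "m + length (nf h) \<le> length (a @ b) + 2 * t"
        using b r_long[OF l] by simp_all
      then show ?thesis
        unfolding val ab using IH(1) t r_l by simp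
    qed
  qed (simp add: nf_one)
  then show ?thesis ..
qed

end

section \<open>Negligible sets of tuples\<close>

context free_group
begin

lemma card_tuples_short_component:
  assumes "finite B" and "i \<le> m"
  shows "card {xs \<in> tuples (word_ball G B p) (Suc m). length (nf (xs ! i)) \<le> q}
         \<le> card (word_ball G B q) * card (word_ball G B p) ^ m" (is "card ?A \<le> _")
proof (rule card_tuples_fibre_le)
  fix xs assume "xs \<in> ?A"
  then have "{x \<in> word_ball G B p. xs[i := x] \<in> ?A} \<subseteq> word_ball G B q"
    using assms(2) by (auto simp: tuples_def word_ball_iff)
  then show "card {x \<in> word_ball G B p. xs[i := x] \<in> ?A} \<le> card (word_ball G B q)"
    by (rule card_mono[OF finite_word_ball[OF assms(1)]])
qed (use assms in \<open>auto simp: finite_word_ball\<close>)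

text \<open>A letter \<open>(i, s)\<close> over the naturals stands for entry \<open>i\<close> of
  the tuple or its inverse. The bound \<open>2 * t\<close> keeps the two ends of a word disjoint
  when both letters refer to the same entry.\<close>

definition common_prefix_tuples :: "nat \<Rightarrow> nat \<Rightarrow> nat \<Rightarrow> nat letter \<Rightarrow> nat letter \<Rightarrow> 'a list set" where
  "common_prefix_tuples p m t l l' =
     {xs \<in> tuples (word_ball G B p) m.
        2 * t \<le> length (nf (xs ! fst l)) \<and> 2 * t \<le> length (nf (xs ! fst l')) \<and>
        take t (nf (letter_val G (apfst ((!) xs) l))) = take t (nf (letter_val G (apfst ((!) xs) l')))}"

text \<open>Entry \<open>fst l\<close> varies. If both letters refer to it, their signs are opposite
  and its word begins with the inverse of its own end; otherwise the other entry prescribes the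
  prefix. Either way the choices number at most the size of the ball of radius
  \<open>p - t\<close>.\<close>

lemma card_common_prefix_tuples:
  assumes B: "finite B" and l: "fst l \<le> m" "fst l' \<le> m" "l \<noteq> l'"
  shows "card (common_prefix_tuples p (Suc m) t l l')
         \<le> card (word_ball G B (p - t)) * card (word_ball G B p) ^ m" (is "card ?A \<le> _")
proof (rule card_tuples_fibre_le)
  obtain i s j s' where ls: "l = (i, s)" "l' = (j, s')"
    by fastforce
  fix xs assume "xs \<in> ?A"
  then have len: "length xs = Suc m" and mem: "\<And>k. k \<le> m \<Longrightarrow> xs ! k \<in> word_ball G B p"
    by (auto simp: common_prefix_tuples_def tuples_def)
  show "card {x \<in> word_ball G B p. xs[fst l := x] \<in> ?A} \<le> card (word_ball G B (p - t))"
  proof (cases "i = j")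
    case True
    then have "s' = (\<not> s)"
      using l ls by auto
    then have "{x \<in> word_ball G B p. xs[fst l := x] \<in> ?A} \<subseteq>
        {x \<in> word_ball G B p. 2 * t \<le> length (nf x) \<and> take t (nf x) = take t (inv_word (nf x))}"
        (is "?F \<subseteq> ?E")
      using l ls len True
      by (auto simp: common_prefix_tuples_def nf_letter_val word_ball_iff split: if_splits)
    then have "card ?F \<le> card ?E"
      by (rule card_mono[rotated]) (simp add: B finite_word_ball)
    also have "\<dots> \<le> card (word_ball G B (p - t))"
      by (rule card_word_ball_self_inverse_prefix[OF B])
    finally show ?thesis .
  next
    case False
    then have "{x \<in> word_ball G B p. xs[fst l := x] \<in> ?A} \<subseteq>
        {x \<in> word_ball G B p. t \<le> length (nf x) \<and>
           take t (nf (letter_val G (x, s))) = take t (nf (letter_val G (xs ! j, s')))}"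
        (is "?F \<subseteq> ?E")
      using l ls len by (auto simp: common_prefix_tuples_def)
    then have "card ?F \<le> card ?E"
      by (rule card_mono[rotated]) (simp add: B finite_word_ball)
    also have "\<dots> \<le> card (word_ball G B (p - t))"
      by (rule card_word_ball_prefix[OF B])
    finally show ?thesis .
  qed
qed (use assms in \<open>auto simp: finite_word_ball common_prefix_tuples_def\<close>)

lemma hom_eq_word_val_nf:
  assumes "group H" "\<phi> \<in> hom G H" "z \<in> carrier G"
  shows "\<phi> z = word_val H (map_word \<phi> (nf z))"
  using hom_word_val[OF group_axioms assms(1,2) nf_fst[OF assms(3)]] assms(3)
  by (simp add: word_val_nf)

lemma hom_eqI:
  assumes "group H" "\<phi> \<in> hom G H" "\<phi>' \<in> hom G H" "z \<in> carrier G"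
    and "\<And>x. x \<in> B \<Longrightarrow> \<phi> x = \<phi>' x"
  shows "\<phi> z = \<phi>' z"
proof -
  have "fst ` set (nf z) \<subseteq> B"
    using assms(4) by (simp add: nf_reduced reduced_words_fst)
  then have "map_word \<phi> (nf z) = map_word \<phi>' (nf z)"
    using assms(5) by auto
  then show ?thesis
    using assms hom_eq_word_val_nf by metis
qed

end

text \<open>The last two entries are \<open>u\<close> and \<open>v\<close>, and \<open>y\<close>
  takes the place of the inverse of \<open>\<psi> z\<close>. The homomorphism is merely required to
  exist: if \<open>as\<close> generates freely, the first entries determine it on the
  carrier.\<close>

definition twisted_tuples ::
  "('a, 'm) monoid_scheme \<Rightarrow> ('b, 'k) monoid_scheme \<Rightarrow> 'a list \<Rightarrow> 'b set \<Rightarrow> 'a \<Rightarrow> 'b \<Rightarrow> 'b list set" where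
  "twisted_tuples G H as X z y =
     {xs \<in> tuples X (Suc (Suc (length as))). \<exists>\<phi> \<in> hom G H. map \<phi> as = take (length as) xs \<and>
        xs ! length as = \<phi> z \<otimes>\<^bsub>H\<^esub> xs ! Suc (length as) \<otimes>\<^bsub>H\<^esub> y}"

text \<open>The entries other than \<open>u\<close> fix \<open>\<phi>\<close> on the generators,
  hence \<open>\<phi> z\<close>, and the equation then leaves at most one \<open>u\<close>.\<close>

lemma card_twisted_tuples:
  assumes "free_generating_set G (set as)" and "group H" and X: "finite X" and z: "z \<in> carrier G"
  shows "card (twisted_tuples G H as X z y) \<le> 1 * card X ^ Suc (length as)"
    (is "card ?A \<le> _")
proof (rule card_tuples_fibre_le)
  interpret G: free_group G "set as"
    using assms(1) by (simp add: free_group_iff)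
  fix xs
  let ?F = "{x \<in> X. xs[length as := x] \<in> ?A}"
  assume "xs \<in> ?A"
  then have len: "length xs = Suc (Suc (length as))"
    by (simp add: twisted_tuples_def tuples_def)
  have "x = x'" if "x \<in> ?F" "x' \<in> ?F" for x x'
  proof -
    obtain \<phi> where \<phi>: "\<phi> \<in> hom G H" "map \<phi> as = take (length as) xs"
        "x = \<phi> z \<otimes>\<^bsub>H\<^esub> xs ! Suc (length as) \<otimes>\<^bsub>H\<^esub> y"
      using \<open>x \<in> ?F\<close> len by (auto simp: twisted_tuples_def)
    obtain \<phi>' where \<phi>': "\<phi>' \<in> hom G H" "map \<phi>' as = take (length as) xs"
        "x' = \<phi>' z \<otimes>\<^bsub>H\<^esub> xs ! Suc (length as) \<otimes>\<^bsub>H\<^esub> y"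
      using \<open>x' \<in> ?F\<close> len by (auto simp: twisted_tuples_def)
    have "\<phi> x = \<phi>' x" if "x \<in> set as" for x
      using \<phi>(2) \<phi>'(2) that by (metis map_eq_conv)
    then have "\<phi> z = \<phi>' z"
      using G.hom_eqI[OF assms(2) \<phi>(1) \<phi>'(1) z] by blast
    then show ?thesis
      using \<phi>(3) \<phi>'(3) by simp
  qed
  then show "card ?F \<le> 1"
    using X by (simp add: card_le_Suc0_iff_eq)
qed (use X in \<open>auto simp: twisted_tuples_def\<close>)

section \<open>The exceptional sets and the limit of the density\<close>

lemma filterlim_div_at_top:
  assumes "k > 0"
  shows "filterlim (\<lambda>p. p div k :: nat) at_top at_top"
  unfolding filterlim_at_top
proof
  fix Z
  show "\<forall>\<^sub>F p in at_top. Z \<le> p div k"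
    using eventually_ge_at_top[of "Z * k"]
    by eventually_elim (use assms in \<open>simp add: less_eq_div_iff_mult_less_eq\<close>)
qed

theorem theorem5:
  fixes G :: "('a, 'm) monoid_scheme" and H :: "('b, 'k) monoid_scheme"
    and as :: "'a list" and n :: nat and B :: "'b set" and \<psi> :: "'a \<Rightarrow> 'b"
  assumes "free_generating_set G (set as)" and "distinct as" and "length as = n"
    and "free_generating_set H B" and "finite B" and "card B > 1"
    and "\<psi> \<in> hom G H"
  shows "generic H B (n + 2)
    {map \<phi> as @ [u, v] | \<phi> u v. \<phi> \<in> hom G H \<and> u \<in> carrier H \<and> v \<in> carrier H \<and>
       \<not> doubly_twisted_conj G H \<phi> \<psi> u v}"
proof -
  interpret G: free_group G "set as"
    using assms(1) by (simp add: free_group_iff)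
  interpret H: free_group H B
    using assms(4) by (simp add: free_group_iff)
  define S where "S = {map \<phi> as @ [u, v] | \<phi> u v. \<phi> \<in> hom G H \<and> u \<in> carrier H \<and> v \<in> carrier H \<and>
       \<not> doubly_twisted_conj G H \<phi> \<psi> u v}"
  define X where "X p = word_ball H B p" for p
  define T where "T p = tuples (X p) (Suc (Suc n))" for p
  \<comment> \<open>\<open>insert 0\<close> gives \<open>Max\<close> a value when \<open>G\<close>
    has rank zero.\<close>
  define c where "c = Max (insert 0 ((\<lambda>x. length (H.nf (\<psi> x))) ` set as))"
  define P where "P = {(l, l') \<in> ({..<n} \<times> (UNIV :: bool set)) \<times> ({..<n} \<times> (UNIV :: bool set)). l \<noteq> l'}"
  \<comment> \<open>Words of length at most 4 are treated one by one; the length estimate excludes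
    all longer ones.\<close>
  define Z where "Z = word_val G ` ball_words (set as) 4"
  \<comment> \<open>The exceptional sets: a generator with a short image, two images or inverses
    with a long common prefix, and a solution with \<open>z\<close> in \<open>Z\<close>.\<close>
  define bad1 where "bad1 p = (\<Union>i<n. {xs \<in> T p. length (H.nf (xs ! i)) \<le> p - p div 8})" for p
  define bad2 where
    "bad2 p = (\<Union>(l, l')\<in>P. H.common_prefix_tuples p (Suc (Suc n)) (p div 8) l l')" for p
  define bad3 where "bad3 p = (\<Union>z\<in>Z. twisted_tuples G H as (X p) z (inv\<^bsub>H\<^esub> \<psi> z))" for p

  have fin_X: "finite (X p)" for p
    using assms(5) by (simp add: X_def H.finite_word_ball)
  have fin_T: "finite (T p)" for p
    by (simp add: T_def finite_tuples fin_X)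
  have card_T: "card (T p) = card (X p) * card (X p) ^ Suc n" for p
    using card_tuples[OF fin_X] by (simp add: T_def)
  have "\<one>\<^bsub>H\<^esub> \<in> X p" for p
    by (simp add: X_def H.word_ball_iff H.nf_one)
  then have X_pos: "card (X p) > 0" for p
    using fin_X by (auto simp: card_gt_0_iff)
  have fin_P: "finite P"
    unfolding P_def by (rule finite_subset[of _ "({..<n} \<times> UNIV) \<times> ({..<n} \<times> UNIV)"]) auto
  have fin_Z: "finite Z"
    by (simp add: Z_def finite_ball_words)
  have \<psi>_closed: "\<psi> z \<in> carrier H" if "z \<in> carrier G" for z
    using assms(7) that by (rule hom_in_carrier)
  have c: "length (H.nf (\<psi> x)) \<le> c" if "x \<in> set as" for x
    using that by (auto simp: c_def intro!: Max_ge)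

  \<comment> \<open>A uniform bound for every member of the three unions: one entry has at most as
    many choices as the smaller ball, the others are free.\<close>
  define N where "N p = card (X (p - p div 8)) * card (X p) ^ Suc n" for p
  have card_bad1: "card (bad1 p) \<le> n * N p" for p
  proof -
    have "card (bad1 p) \<le> (\<Sum>i<n. card {xs \<in> T p. length (H.nf (xs ! i)) \<le> p - p div 8})"
      unfolding bad1_def by (rule card_UN_le) simp
    also have "\<dots> \<le> of_nat (card {..<n}) * N p"
      unfolding T_def N_def X_def
      by (intro sum_bounded_above H.card_tuples_short_component) (use assms(5) in auto)
    finally show ?thesis
      by simp
  qed
  have card_bad2: "card (bad2 p) \<le> card P * N p" for p
  proof -
    have "card (bad2 p) \<le> (\<Sum>(l, l')\<in>P. card (H.common_prefix_tuples p (Suc (Suc n)) (p div 8) l l'))"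
      unfolding bad2_def case_prod_beta by (rule card_UN_le[OF fin_P])
    also have "\<dots> \<le> of_nat (card P) * N p"
    proof (rule sum_bounded_above)
      fix ll assume "ll \<in> P"
      then obtain l l' where ll: "ll = (l, l')" and l: "fst l < n" "fst l' < n" "l \<noteq> l'"
        by (cases ll) (simp add: P_def mem_Times_iff)
      have "card (H.common_prefix_tuples p (Suc (Suc n)) (p div 8) l l') \<le> N p"
        unfolding N_def X_def using l by (intro H.card_common_prefix_tuples assms(5)) simp_all
      then show "(case ll of (l, l') \<Rightarrow> card (H.common_prefix_tuples p (Suc (Suc n)) (p div 8) l l')) \<le> N p"
        by (simp add: ll)
    qed
    finally show ?thesis
      by simp
  qed
  have card_bad3: "card (bad3 p) \<le> card Z * N p" for p
  proof -
    have "card (bad3 p) \<le> (\<Sum>z\<in>Z. card (twisted_tuples G H as (X p) z (inv\<^bsub>H\<^esub> \<psi> z)))"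
      unfolding bad3_def by (rule card_UN_le[OF fin_Z])
    also have "\<dots> \<le> of_nat (card Z) * N p"
    proof (rule sum_bounded_above)
      fix z assume "z \<in> Z"
      then have "z \<in> carrier G"
        by (auto simp: Z_def intro!: G.word_val_closed G.fst_reduced_closed[THEN subsetD])
      then have "card (twisted_tuples G H as (X p) z (inv\<^bsub>H\<^esub> \<psi> z)) \<le> 1 * card (X p) ^ Suc n"
        using card_twisted_tuples[OF assms(1) H.is_group fin_X] assms(3) by blast
      \<comment> \<open>The smaller ball contains the identity, so its cardinality is at least
        one.\<close>
      also have "\<dots> \<le> N p"
        unfolding N_def using X_pos by (intro mult_le_mono1) (simp add: Suc_le_eq)
      finally show "card (twisted_tuples G H as (X p) z (inv\<^bsub>H\<^esub> \<psi> z)) \<le> N p" .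
    qed
    finally show ?thesis
      by simp
  qed

  have cover: "T p - S \<subseteq> bad1 p \<union> bad2 p \<union> bad3 p" if p: "p > 5 * c" for p
  proof
    fix xs assume xs: "xs \<in> T p - S"
    define t where "t = p div 8"
    have t: "8 * t \<le> p"
      by (simp add: t_def)
    have len: "length xs = Suc (Suc n)" and mem: "\<And>k. k < Suc (Suc n) \<Longrightarrow> xs ! k \<in> X p"
      using xs by (auto simp: T_def tuples_def)
    show "xs \<in> bad1 p \<union> bad2 p \<union> bad3 p"
    proof (rule ccontr)
      assume good: "xs \<notin> bad1 p \<union> bad2 p \<union> bad3 p"
      \<comment> \<open>Reads the first \<open>n\<close> entries as values on the generators;
        \<open>distinct as\<close> makes the lookup return the entry at the matching index.\<close>
      define f where "f x = the (map_of (zip as (take n xs)) x)" for x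
      have f_nth: "f (as ! i) = xs ! i" if "i < n" for i
        using that assms(2,3) len by (simp add: f_def map_of_zip_nth)
      have "f ` set as \<subseteq> carrier H"
        using f_nth mem assms(3) by (force simp: in_set_conv_nth X_def H.word_ball_iff)
      then obtain \<phi> where \<phi>: "\<phi> \<in> hom G H" and \<phi>_f: "\<And>x. x \<in> set as \<Longrightarrow> \<phi> x = f x"
        using G.hom_exists[OF H.is_group] by blast
      have \<phi>_nth: "\<phi> (as ! i) = xs ! i" if "i < n" for i
        using that f_nth \<phi>_f assms(3) by simp
      have map_\<phi>: "map \<phi> as = take n xs"
        using \<phi>_nth len assms(3) by (intro nth_equalityI) auto
      have split: "xs = map \<phi> as @ [xs ! n, xs ! Suc n]"
        using len by (simp add: map_\<phi> flip: Cons_nth_drop_Suc take_Suc_conv_app_nth)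
          (metis Cons_nth_drop_Suc append_take_drop_id drop_all le_refl lessI less_SucI)
      have uv: "xs ! n \<in> carrier H" "xs ! Suc n \<in> carrier H"
        "length (H.nf (xs ! n)) \<le> p" "length (H.nf (xs ! Suc n)) \<le> p"
        using mem[of n] mem[of "Suc n"] by (auto simp: X_def H.word_ball_iff)
      have "doubly_twisted_conj G H \<phi> \<psi> (xs ! n) (xs ! Suc n)"
        using xs split \<phi> uv(1,2) unfolding S_def by blast
      then obtain z where z: "z \<in> carrier G"
        and eq: "xs ! n = \<phi> z \<otimes>\<^bsub>H\<^esub> xs ! Suc n \<otimes>\<^bsub>H\<^esub> inv\<^bsub>H\<^esub> \<psi> z"
        unfolding doubly_twisted_conj_def by blast
      have \<phi>z: "\<phi> z \<in> carrier H"
        using \<phi> z by (rule hom_in_carrier)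
      define k where "k = length (G.nf z)"
      \<comment> \<open>For \<open>z\<close> in \<open>Z\<close> the equation would put
        \<open>xs\<close> in \<open>bad3 p\<close>.\<close>
      have "z \<notin> Z"
        using good xs \<phi> eq map_\<phi> assms(3) by (auto simp: bad3_def twisted_tuples_def T_def)
      then have k: "k \<ge> 5"
        using z G.nf_reduced G.word_val_nf[symmetric] by (fastforce simp: Z_def k_def)
      have long: "p - t \<le> length (H.nf (\<phi> x))" if "x \<in> set as" for x
        using that good xs \<phi>_nth assms(3)
        by (force simp: in_set_conv_nth bad1_def t_def not_le)
      have \<phi>_as: "\<phi> ` set as \<subseteq> carrier H"
        using \<open>f ` set as \<subseteq> carrier H\<close> \<phi>_f by auto
      \<comment> \<open>Avoiding \<open>bad1 p\<close> makes the images long, with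
        \<open>m = p - t\<close>; avoiding \<open>bad2 p\<close> makes the prefixes of distinct
        letters differ.\<close>
      have "k * (p - t - 2 * t) \<le> length (H.nf (word_val H (map_word \<phi> (G.nf z))))"
        unfolding k_def
      proof (rule H.length_nf_map_word_ge[OF \<phi>_as long])
        fix l l' :: "'a letter"
        assume l: "fst l \<in> set as" "fst l' \<in> set as" "l \<noteq> l'"
        obtain i j where ij: "i < n" "j < n" "fst l = as ! i" "fst l' = as ! j"
          using l assms(3) by (metis in_set_conv_nth)
        have "((i, snd l), (j, snd l')) \<in> P"
          using ij l(3) by (auto simp: P_def prod_eq_iff)
        then have "xs \<notin> H.common_prefix_tuples p (Suc (Suc n)) t (i, snd l) (j, snd l')"
          using good by (auto simp: bad2_def t_def)
        moreover have "2 * t \<le> length (H.nf (xs ! i))" "2 * t \<le> length (H.nf (xs ! j))"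
          using long[OF l(1)] long[OF l(2)] t ij \<phi>_nth by auto
        moreover have "apfst \<phi> l = (xs ! i, snd l)" "apfst \<phi> l' = (xs ! j, snd l')"
          using ij \<phi>_nth by (simp_all add: prod_eq_iff)
        ultimately show "take t (H.nf (letter_val H (apfst \<phi> l))) \<noteq> take t (H.nf (letter_val H (apfst \<phi> l')))"
          using xs by (simp add: H.common_prefix_tuples_def T_def X_def)
      qed (use t G.nf_reduced[OF z] in auto)
      then have lower: "k * (p - 3 * t) \<le> length (H.nf (\<phi> z))"
        using G.hom_eq_word_val_nf[OF H.is_group \<phi> z] by simp
      \<comment> \<open>Solved for \<open>\<phi> z\<close>, the equation gives an upper bound whose
        growth in \<open>k\<close> has slope only \<open>c\<close>.\<close>
      have "\<phi> z = xs ! n \<otimes>\<^bsub>H\<^esub> \<psi> z \<otimes>\<^bsub>H\<^esub> inv\<^bsub>H\<^esub> (xs ! Suc n)"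
        using uv \<psi>_closed[OF z] \<phi>z eq by (metis H.inv_solve_right H.inv_closed H.inv_inv H.m_closed)
      then have "length (H.nf (\<phi> z))
          \<le> length (H.nf (xs ! n)) + length (H.nf (\<psi> z)) + length (H.nf (xs ! Suc n))"
        using H.length_nf_mult[of "xs ! n \<otimes>\<^bsub>H\<^esub> \<psi> z" "inv\<^bsub>H\<^esub> (xs ! Suc n)"]
          H.length_nf_mult[of "xs ! n" "\<psi> z"] uv \<psi>_closed[OF z] by (simp add: H.nf_inv)
      moreover have "length (H.nf (\<psi> z)) \<le> k * c"
        unfolding k_def G.hom_eq_word_val_nf[OF H.is_group assms(7) z]
        by (rule H.length_nf_map_word_le[where A = "set as"])
          (use c \<psi>_closed G.generators_closed reduced_words_fst[OF G.nf_reduced[OF z]] in auto)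
      ultimately have "k * (p - 3 * t) \<le> 2 * p + k * c"
        using lower uv by linarith
      \<comment> \<open>These use \<open>8 * t \<le> p\<close>, \<open>p > 5 * c\<close> and
        \<open>k \<ge> 5\<close>. Together they give \<open>25 * k * p \<le> 40 * k * (p - 3 * t)
        \<le> 80 * p + 40 * k * c \<le> 24 * k * p\<close>, impossible for positive
        \<open>k * p\<close>.\<close>
      moreover have "k * (5 * p) \<le> k * (8 * (p - 3 * t))" "k * (5 * c) \<le> k * p" "5 * p \<le> k * p"
        using t p k by (auto intro!: mult_le_mono)
      then have "5 * (k * p) \<le> 8 * (k * (p - 3 * t))" "5 * (k * c) \<le> k * p" "5 * p \<le> k * p"
        by (simp_all only: mult.left_commute)
      ultimately show False
        using p by linarith
    qed
  qed

  define M where "M = n + card P + card Z"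
  have card_bad: "card (T p - S) \<le> M * N p" if p: "p > 5 * c" for p
  proof -
    have "finite (bad1 p \<union> bad2 p \<union> bad3 p)"
      by (rule finite_subset[OF _ fin_T[of p]])
        (auto simp: bad1_def bad2_def bad3_def H.common_prefix_tuples_def twisted_tuples_def T_def X_def assms(3))
    then have "card (T p - S) \<le> card (bad1 p \<union> bad2 p \<union> bad3 p)"
      using cover[OF p] by (rule card_mono)
    also have "\<dots> \<le> card (bad1 p) + card (bad2 p) + card (bad3 p)"
      by (meson add_le_mono1 card_Un_le order_trans)
    also have "\<dots> \<le> M * N p"
      using card_bad1[of p] card_bad2[of p] card_bad3[of p] by (simp add: M_def algebra_simps)
    finally show ?thesis .
  qed
  \<comment> \<open>The deviation from 1 is the proportion of \<open>T p\<close> outside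
    \<open>S\<close>. In \<open>N p\<close> one factor is the smaller ball, which gains the factor
    \<open>2 ^ (p div 8)\<close>.\<close>
  have bound: "norm (real (card (S \<inter> T p)) / real (card (T p)) - 1) \<le> real M * (1 / 2) ^ (p div 8)"
    if p: "p > 5 * c" for p
  proof -
    have "real (card (T p)) = real (card (S \<inter> T p)) + real (card (T p - S))"
      using card_Int_Diff[OF fin_T, of p S] by (simp add: Int_commute)
    moreover have T_pos: "real (card (T p)) > 0"
      using X_pos by (simp add: card_T)
    ultimately have "norm (real (card (S \<inter> T p)) / real (card (T p)) - 1)
        = real (card (T p - S)) / real (card (T p))"
      by (simp add: field_simps)
    also have "\<dots> \<le> real M * (1 / 2) ^ (p div 8)"
    proof -
      have "2 ^ (p div 8) * card (X (p - p div 8)) \<le> card (X p)"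
        using card_ball_words_diff[OF assms(5,6), of "p div 8" p] by (simp add: X_def H.card_word_ball)
      then have "2 ^ (p div 8) * N p \<le> card (T p)"
        unfolding N_def card_T mult.assoc[symmetric] by (rule mult_le_mono1)
      then have le: "M * (2 ^ (p div 8) * N p) \<le> M * card (T p)"
        by (rule mult_le_mono2)
      have "2 ^ (p div 8) * card (T p - S) \<le> 2 ^ (p div 8) * (M * N p)"
        using card_bad[OF p] by (rule mult_le_mono2)
      also have "\<dots> = M * (2 ^ (p div 8) * N p)"
        by (rule mult.left_commute)
      also note le
      finally have "real (2 ^ (p div 8) * card (T p - S)) \<le> real (M * card (T p))"
        by (rule of_nat_mono)
      then have "2 ^ (p div 8) * real (card (T p - S)) \<le> real M * real (card (T p))"
        by (simp only: of_nat_mult of_nat_power of_nat_numeral)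
      then show ?thesis
        using T_pos by (simp add: field_simps power_divide)
    qed
    finally show ?thesis .
  qed
  have "(\<lambda>q. real M * (1 / 2) ^ q) \<longlonglongrightarrow> 0"
    by (intro tendsto_mult_right_zero LIMSEQ_power_zero) simp
  then have "(\<lambda>p. real M * (1 / 2) ^ (p div 8)) \<longlonglongrightarrow> 0"
    by (rule filterlim_compose) (simp add: filterlim_div_at_top)
  moreover have "\<forall>\<^sub>F p in sequentially. norm (real (card (S \<inter> T p)) / real (card (T p)) - 1)
      \<le> norm (real M * (1 / 2) ^ (p div 8)) * 1"
    using eventually_gt_at_top[of "5 * c"] by eventually_elim (use bound in simp)
  ultimately have "(\<lambda>p. real (card (S \<inter> T p)) / real (card (T p)) - 1) \<longlonglongrightarrow> 0"
    by (rule tendsto_0_le)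
  then have "has_asymptotic_density H B (n + 2) S 1"
    by (simp add: has_asymptotic_density_def T_def X_def LIM_zero_iff)
  moreover have "S \<subseteq> tuples (carrier H) (n + 2)"
  proof
    fix xs assume "xs \<in> S"
    then obtain \<phi> u v where xs: "xs = map \<phi> as @ [u, v]" and "\<phi> \<in> hom G H"
      and uv: "u \<in> carrier H" "v \<in> carrier H"
      unfolding S_def by blast
    then have "\<phi> ` set as \<subseteq> carrier H"
      using G.generators_closed hom_in_carrier[of \<phi> G H] by blast
    then show "xs \<in> tuples (carrier H) (n + 2)"
      using xs uv assms(3) by (simp add: tuples_def)
  qed
  ultimately show ?thesis
    by (simp add: generic_def S_def)
qed

end
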